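(* Let $A$ be a commutative ring with identity. If $\mathfrak{q}$ is a quasi-prime ideal of $A$, then the closure of $\{\mathfrak{q}\}$ in $\operatorname{Sq} A$ is $\overline{\{\mathfrak{q}\}}=\{\mathfrak{p}\in\operatorname{Sq} A: \mathfrak{q}\subseteq\sqrt{\mathfrak{p}}\}$.
   Context: A proper ideal $\mathfrak{q}$ of $A$ is called quasi-prime if whenever $fg\in\mathfrak{q}$ with $f,g\in A$, then $f\in\sqrt{\mathfrak{q}}$ or $g\in\sqrt{\mathfrak{q}}$. The quasi-prime spectrum $\operatorname{Sq} A$ is the set of all quasi-prime ideals of $A$, with the topology having as basis of opens the sets $U_f=\{\mathfrak{q}\in\operatorname{Sq} A: \mathfrak{q}\cap S_f=\emptyset\}$ for $f\in A$, where $S_f=\{f^i : i\ge 0\}=\{1,f,f^2,\dots\}$. *)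

theory Defs
  imports "HOL-Algebra.Ideal" "HOL-Analysis.Abstract_Topology"
begin

definition radical :: "('a, 'm) ring_scheme \<Rightarrow> 'a set \<Rightarrow> 'a set"
  where "radical A I = {f \<in> carrier A. \<exists>n::nat. n > 0 \<and> f [^]\<^bsub>A\<^esub> n \<in> I}"

locale quasiprimeideal = ideal + cring +
  assumes I_notcarr: "carrier R \<noteq> I"
    and I_quasiprime:
      "\<lbrakk>f \<in> carrier R; g \<in> carrier R; f \<otimes> g \<in> I\<rbrakk> \<Longrightarrow> f \<in> radical R I \<or> g \<in> radical R I"

definition Sq :: "('a, 'm) ring_scheme \<Rightarrow> 'a set set"
  where "Sq A = {\<qq>. quasiprimeideal \<qq> A}"

definition powers_of :: "('a, 'm) ring_scheme \<Rightarrow> 'a \<Rightarrow> 'a set"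
  where "powers_of A f = {f [^]\<^bsub>A\<^esub> i |i::nat. True}"

definition Sq_basic :: "('a, 'm) ring_scheme \<Rightarrow> 'a \<Rightarrow> 'a set set"
  where "Sq_basic A f = {\<qq> \<in> Sq A. \<qq> \<inter> powers_of A f = {}}"

(* The const topology is only meaningful on predicates satisfying istopology;
   lemma openin_Sq_topology shows that this is the case here, so that the sets
   Sq_basic A f really form a basis, and topspace_Sq_topology that the
   underlying set is Sq A. *)
definition Sq_topology :: "('a, 'm) ring_scheme \<Rightarrow> 'a set topology"
  where "Sq_topology A = topology (arbitrary union_of (\<lambda>U. \<exists>f\<in>carrier A. U = Sq_basic A f))"

lemma (in quasiprimeideal) one_notin: "\<one> \<notin> I"
  using I_notcarr one_imp_carrier by blast

lemma (in cring) Sq_basic_one: "Sq_basic R \<one> = Sq R"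
  by (auto simp: Sq_basic_def powers_of_def Sq_def dest: quasiprimeideal.one_notin)

lemma (in cring) Sq_basic_Int:
  assumes f: "f \<in> carrier R" and g: "g \<in> carrier R"
  shows "Sq_basic R f \<inter> Sq_basic R g = Sq_basic R (f \<otimes> g)"
proof -
  have "(\<exists>i::nat. (f \<otimes> g) [^] i \<in> \<qq>) \<longleftrightarrow> (\<exists>i::nat. f [^] i \<in> \<qq>) \<or> (\<exists>i::nat. g [^] i \<in> \<qq>)"
    if "quasiprimeideal \<qq> R" for \<qq>
  proof -
    interpret \<qq>: quasiprimeideal \<qq> R by fact
    have *: "(f \<otimes> g) [^] i = f [^] i \<otimes> g [^] i" for i :: nat
      using f g by (rule nat_pow_distrib)
    have "\<exists>j::nat. x [^] j \<in> \<qq>" if "x [^] i \<in> radical R \<qq>" "x \<in> carrier R" for x and i :: nat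
      using that by (auto simp: radical_def nat_pow_pow)
    then show ?thesis
      using \<qq>.I_quasiprime \<qq>.I_l_closed \<qq>.I_r_closed f g by (metis * nat_pow_closed)
  qed
  then show ?thesis
    unfolding Sq_basic_def powers_of_def Sq_def disjoint_iff by blast
qed

lemma (in cring) openin_Sq_topology:
  "openin (Sq_topology R) = arbitrary union_of (\<lambda>U. \<exists>f\<in>carrier R. U = Sq_basic R f)"
  unfolding Sq_topology_def
  by (rule topology_inverse', rule istopology_base) (metis Sq_basic_Int m_closed)

lemma (in cring) topspace_Sq_topology: "topspace (Sq_topology R) = Sq R"
proof -
  have "openin (Sq_topology R) (Sq R)"
    unfolding openin_Sq_topology by (rule union_of_inc) (auto simp: arbitrary_def Sq_basic_one[symmetric])
  moreover have "U \<subseteq> Sq R" if "openin (Sq_topology R) U" for U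
    using that unfolding openin_Sq_topology union_of_def Sq_basic_def by blast
  ultimately show ?thesis
    by (meson openin_subset openin_topspace subset_antisym)
qed

end

theory Submission
  imports Defs
begin

text \<open>For a quasi-prime ideal \<open>\<pp>\<close> the condition \<open>\<pp> \<in> U\<^sub>f\<close> just says \<open>f \<notin> \<surd>\<pp>\<close>, because \<open>\<pp>\<close> is proper
  and so the power \<open>f\<^sup>0 = 1\<close> never meets it. The point \<open>\<pp>\<close> lies in the closure of \<open>{\<qq>}\<close> iff every
  basic open set that contains \<open>\<pp>\<close> contains \<open>\<qq>\<close>, i.e. iff \<open>f \<notin> \<surd>\<pp>\<close> implies \<open>f \<notin> \<surd>\<qq>\<close> for all \<open>f\<close>.
  This is \<open>\<surd>\<qq> \<subseteq> \<surd>\<pp>\<close>, which is equivalent to \<open>\<qq> \<subseteq> \<surd>\<pp>\<close> since taking radicals is a closure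
  operator.\<close>

lemma radical_subset_carrier: "radical A I \<subseteq> carrier A"
  by (auto simp: radical_def)

text \<open>A radical absorbs roots: if some power of \<open>f\<close> lies in \<open>I \<subseteq> \<surd>J\<close>, then a power of that power lies
  in \<open>J\<close>. Conversely \<open>I \<subseteq> \<surd>I\<close>, with exponent \<open>1\<close>.\<close>

lemma (in ring) radical_subset_radical_iff:
  assumes "I \<subseteq> carrier R"
  shows "radical R I \<subseteq> radical R J \<longleftrightarrow> I \<subseteq> radical R J"
proof
  have "I \<subseteq> radical R I"
    using assms by (force simp: radical_def intro: exI[of _ "1::nat"])
  then show "I \<subseteq> radical R J" if "radical R I \<subseteq> radical R J"
    using that by blast
next
  assume sub: "I \<subseteq> radical R J"
  show "radical R I \<subseteq> radical R J"
  proof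
    fix f
    assume "f \<in> radical R I"
    then obtain n :: nat where f: "f \<in> carrier R" and n: "n > 0" "f [^] n \<in> I"
      by (auto simp: radical_def)
    then obtain m :: nat where m: "m > 0" "(f [^] n) [^] m \<in> J"
      using sub by (auto simp: radical_def)
    have "f [^] (n * m) \<in> J"
      using m f by (simp add: nat_pow_pow)
    moreover have "n * m > 0"
      using n m by simp
    ultimately show "f \<in> radical R J"
      using f unfolding radical_def by blast
  qed
qed

text \<open>The set \<open>powers_of R f\<close> contains \<open>f\<^sup>0 = \<one>\<close>, while the radical asks for positive exponents; the
  two agree because a quasi-prime ideal is proper.\<close>

lemma (in quasiprimeideal) mem_Sq_basic_iff_notin_radical:
  assumes "f \<in> carrier R"
  shows "I \<in> Sq_basic R f \<longleftrightarrow> f \<notin> radical R I"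
proof -
  have "i > 0" if "f [^] i \<in> I" for i :: nat
    using that one_notin by (cases i) auto
  then have "I \<inter> powers_of R f = {} \<longleftrightarrow> f \<notin> radical R I"
    using assms unfolding powers_of_def radical_def by blast
  moreover have "I \<in> Sq R"
    unfolding Sq_def using quasiprimeideal_axioms by simp
  ultimately show ?thesis
    by (simp add: Sq_basic_def)
qed

lemma (in cring) openin_Sq_topology_iff:
  "openin (Sq_topology R) T \<longleftrightarrow>
    (\<forall>\<pp>\<in>T. \<exists>f\<in>carrier R. \<pp> \<in> Sq_basic R f \<and> Sq_basic R f \<subseteq> T)"
  unfolding openin_Sq_topology arbitrary_union_of_alt by blast

lemma (in cring) in_closure_of_Sq_topology_iff:
  "\<pp> \<in> Sq_topology R closure_of {\<qq>} \<longleftrightarrow>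
    \<pp> \<in> Sq R \<and> (\<forall>f\<in>carrier R. \<pp> \<in> Sq_basic R f \<longrightarrow> \<qq> \<in> Sq_basic R f)"
proof -
  have "openin (Sq_topology R) (Sq_basic R f)" if "f \<in> carrier R" for f
    using that by (auto simp: openin_Sq_topology_iff)
  then have "(\<forall>T. \<pp> \<in> T \<and> openin (Sq_topology R) T \<longrightarrow> \<qq> \<in> T) \<longleftrightarrow>
      (\<forall>f\<in>carrier R. \<pp> \<in> Sq_basic R f \<longrightarrow> \<qq> \<in> Sq_basic R f)"
    by (meson openin_Sq_topology_iff subsetD)
  then show ?thesis
    by (simp add: in_closure_of topspace_Sq_topology)
qed

theorem theorem2p5:
  fixes A :: "('a, 'm) ring_scheme" and \<qq> :: "'a set"
  assumes "cring A" and "quasiprimeideal \<qq> A"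
  shows "Sq_topology A closure_of {\<qq>} = {\<pp> \<in> Sq A. \<qq> \<subseteq> radical A \<pp>}"
proof -
  interpret cring A by fact
  interpret \<qq>: quasiprimeideal \<qq> A by fact
  have "(\<forall>f\<in>carrier A. \<pp> \<in> Sq_basic A f \<longrightarrow> \<qq> \<in> Sq_basic A f) \<longleftrightarrow> \<qq> \<subseteq> radical A \<pp>"
    if "\<pp> \<in> Sq A" for \<pp>
  proof -
    interpret \<pp>: quasiprimeideal \<pp> A
      using that by (simp add: Sq_def)
    have "(\<forall>f\<in>carrier A. \<pp> \<in> Sq_basic A f \<longrightarrow> \<qq> \<in> Sq_basic A f) \<longleftrightarrow>
        radical A \<qq> \<subseteq> radical A \<pp>"
      using radical_subset_carrier[of A \<qq>]
      by (auto simp: \<pp>.mem_Sq_basic_iff_notin_radical \<qq>.mem_Sq_basic_iff_notin_radical)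
    also have "\<dots> \<longleftrightarrow> \<qq> \<subseteq> radical A \<pp>"
      using \<qq>.a_subset by (rule radical_subset_radical_iff)
    finally show ?thesis .
  qed
  then show ?thesis
    unfolding set_eq_iff in_closure_of_Sq_topology_iff mem_Collect_eq by blast
qed

end
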